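(* For a fixed permutation $\sigma$, there is an algorithm which, given a permutation $\pi$ as input, computes $\mathrm{NE}(\sigma,\pi)$ in time polynomial in the length of $\pi$.
   Context: A permutation of length $n\ge1$ is written in one-line notation $\pi=\pi_1\cdots\pi_n$. An occurrence of $\sigma$ in $\pi$ is a subsequence of $\pi$ (a choice of positions) whose letters are in the same relative order of size as the letters of $\sigma$. An adjacency in a permutation $\pi$ is a maximal sequence (of length $\ge 1$) of letters in consecutive positions that have consecutive values and are increasing or decreasing. The tail of an adjacency of length at least 2 is all but its first letter; an adjacency of length 1 has no tail. An embedding $\eta$ of $\sigma$ in $\pi$ is a sequence of the same length as $\pi$ whose nonzero letters are the letters of an occurrence of $\sigma$ in $\pi$, in the same positions as in $\pi$, all other entries being $0$. An embedding $\eta$ is normal if $\eta_i\neq 0$ at every position $i$ of a letter belonging to the tail of an adjacency of $\pi$. $\mathrm{NE}(\sigma,\pi)$ is the number of normal embeddings of $\sigma$ in $\pi$. *)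

theory Defs
  imports "HOL-Combinatorics.Multiset_Permutations" "HOL-Computational_Algebra.Polynomial"
begin

section \<open>Normal embeddings\<close>

text \<open>Permutations are in one-line notation with letters $1, \dots, n$; positions are
  counted from 0, as usual for lists.\<close>

definition is_perm :: "nat list \<Rightarrow> bool" where
  "is_perm \<pi> \<longleftrightarrow> length \<pi> \<ge> 1 \<and> \<pi> \<in> permutations_of_set {1..length \<pi>}"

definition same_relative_order :: "nat list \<Rightarrow> nat list \<Rightarrow> bool" where
  "same_relative_order xs ys \<longleftrightarrow> length xs = length ys \<and>
     (\<forall>i<length xs. \<forall>j<length xs. xs ! i < xs ! j \<longleftrightarrow> ys ! i < ys ! j)"

definition occurrence :: "nat list \<Rightarrow> nat list \<Rightarrow> nat set \<Rightarrow> bool" where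
  "occurrence \<sigma> \<pi> I \<longleftrightarrow> I \<subseteq> {..<length \<pi>} \<and> same_relative_order (nths \<pi> I) \<sigma>"

definition embedding :: "nat list \<Rightarrow> nat list \<Rightarrow> nat list \<Rightarrow> bool" where
  "embedding \<sigma> \<pi> \<eta> \<longleftrightarrow> length \<eta> = length \<pi> \<and>
     (\<exists>I. occurrence \<sigma> \<pi> I \<and> (\<forall>i<length \<pi>. \<eta> ! i = (if i \<in> I then \<pi> ! i else 0)))"

text \<open>\<open>consecutive_run \<pi> i j\<close> concerns the letters at the positions \<open>i\<close> to \<open>j\<close>, both
  included; it always holds for \<open>i = j\<close>.\<close>

definition consecutive_run :: "nat list \<Rightarrow> nat \<Rightarrow> nat \<Rightarrow> bool" where
  "consecutive_run \<pi> i j \<longleftrightarrow> i \<le> j \<and> j < length \<pi> \<and>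
     ((\<forall>k\<in>{i..<j}. \<pi> ! Suc k = \<pi> ! k + 1) \<or> (\<forall>k\<in>{i..<j}. \<pi> ! k = \<pi> ! Suc k + 1))"

definition adjacency :: "nat list \<Rightarrow> nat \<Rightarrow> nat \<Rightarrow> bool" where
  "adjacency \<pi> i j \<longleftrightarrow> consecutive_run \<pi> i j \<and>
     (\<forall>i' j'. consecutive_run \<pi> i' j' \<and> {i..j} \<subseteq> {i'..j'} \<longrightarrow> {i'..j'} = {i..j})"

definition in_tail :: "nat list \<Rightarrow> nat \<Rightarrow> bool" where
  "in_tail \<pi> k \<longleftrightarrow> (\<exists>i j. adjacency \<pi> i j \<and> i < k \<and> k \<le> j)"

definition normal_embedding :: "nat list \<Rightarrow> nat list \<Rightarrow> nat list \<Rightarrow> bool" where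
  "normal_embedding \<sigma> \<pi> \<eta> \<longleftrightarrow> embedding \<sigma> \<pi> \<eta> \<and>
     (\<forall>k<length \<pi>. in_tail \<pi> k \<longrightarrow> \<eta> ! k \<noteq> 0)"

definition NE :: "nat list \<Rightarrow> nat list \<Rightarrow> nat" where
  "NE \<sigma> \<pi> = card {\<eta>. normal_embedding \<sigma> \<pi> \<eta>}"


section \<open>Algorithms and running time\<close>

text \<open>An algorithm is a program of a random access machine over the natural numbers, with
  structured control flow. A program mentions finitely many registers; the memory is
  addressed only indirectly, through the contents of registers. Every elementary instruction
  and every test costs one time unit. Since addition and truncated subtraction are the only
  arithmetic operations, a number occurring within \<open>t\<close> steps is at most $2^t$ times the
  maximum of the input numbers and the constants of the program, so the machine and a
  Turing machine simulate each other with polynomial overhead. (With multiplication in unit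
  time this would fail.)\<close>

datatype prog =
    Skip
  | Const nat nat      \<comment> \<open>\<open>Const r n\<close>: register \<open>r\<close> := \<open>n\<close>\<close>
  | Copy nat nat       \<comment> \<open>\<open>Copy r a\<close>: register \<open>r\<close> := register \<open>a\<close>\<close>
  | Add nat nat nat    \<comment> \<open>\<open>Add r a b\<close>: register \<open>r\<close> := register \<open>a\<close> + register \<open>b\<close>\<close>
  | Sub nat nat nat    \<comment> \<open>likewise with subtraction truncated at 0\<close>
  | Load nat nat       \<comment> \<open>\<open>Load r a\<close>: register \<open>r\<close> := memory cell with address register \<open>a\<close>\<close>
  | Store nat nat      \<comment> \<open>\<open>Store a r\<close>: memory cell with address register \<open>a\<close> := register \<open>r\<close>\<close>
  | Seq prog prog
  | IfNZ nat prog prog   \<comment> \<open>tests whether the register is nonzero\<close>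
  | WhileNZ nat prog     \<comment> \<open>repeats as long as the register is nonzero\<close>

type_synonym state = "(nat \<Rightarrow> nat) \<times> (nat \<Rightarrow> nat)"  \<comment> \<open>registers and memory\<close>

text \<open>\<open>exec P s t s'\<close>: started in \<open>s\<close>, the program \<open>P\<close> halts in \<open>s'\<close> after \<open>t\<close> time units.\<close>

inductive exec :: "prog \<Rightarrow> state \<Rightarrow> nat \<Rightarrow> state \<Rightarrow> bool" where
  Skip: "exec Skip s 1 s"
| Const: "exec (Const r n) (R, M) 1 (R(r := n), M)"
| Copy: "exec (Copy r a) (R, M) 1 (R(r := R a), M)"
| Add: "exec (Add r a b) (R, M) 1 (R(r := R a + R b), M)"
| Sub: "exec (Sub r a b) (R, M) 1 (R(r := R a - R b), M)"
| Load: "exec (Load r a) (R, M) 1 (R(r := M (R a)), M)"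
| Store: "exec (Store a r) (R, M) 1 (R, M(R a := R r))"
| Seq: "exec P s t s' \<Longrightarrow> exec Q s' u s'' \<Longrightarrow> exec (Seq P Q) s (t + u) s''"
| IfTrue: "fst s a \<noteq> 0 \<Longrightarrow> exec P s t s' \<Longrightarrow> exec (IfNZ a P Q) s (1 + t) s'"
| IfFalse: "fst s a = 0 \<Longrightarrow> exec Q s t s' \<Longrightarrow> exec (IfNZ a P Q) s (1 + t) s'"
| WhileTrue: "fst s a \<noteq> 0 \<Longrightarrow> exec P s t s' \<Longrightarrow> exec (WhileNZ a P) s' u s'' \<Longrightarrow>
    exec (WhileNZ a P) s (1 + t + u) s''"
| WhileFalse: "fst s a = 0 \<Longrightarrow> exec (WhileNZ a P) s 1 s"

inductive_cases exec_elims: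
  "exec Skip s t s'" "exec (Const r n) s t s'" "exec (Copy r a) s t s'"
  "exec (Add r a b) s t s'" "exec (Sub r a b) s t s'" "exec (Load r a) s t s'"
  "exec (Store a r) s t s'" "exec (Seq P Q) s t s'" "exec (IfNZ a P Q) s t s'"
  "exec (WhileNZ a P) s t s'"

lemma exec_deterministic:
  "exec P s t s' \<Longrightarrow> exec P s u s'' \<Longrightarrow> u = t \<and> s'' = s'"
proof (induction arbitrary: u s'' rule: exec.induct)
  case (Seq P s t s' Q u0 s0)
  from Seq.prems obtain t1 s1 u1
    where 1: "exec P s t1 s1" "exec Q s1 u1 s''" "u = t1 + u1"
    by (rule exec_elims(8))
  from Seq.IH(1)[OF 1(1)] have "t1 = t" "s1 = s'" by blast+
  with 1 Seq.IH(2)[of u1 s''] show ?case by simp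
next
  case (IfTrue s a P t s' Q)
  from IfTrue.prems IfTrue.hyps obtain t1 where "exec P s t1 s''" "u = 1 + t1"
    by (auto elim: exec_elims(9))
  with IfTrue.IH[of t1 s''] show ?case by simp
next
  case (IfFalse s a Q t s' P)
  from IfFalse.prems IfFalse.hyps obtain t1 where "exec Q s t1 s''" "u = 1 + t1"
    by (auto elim: exec_elims(9))
  with IfFalse.IH[of t1 s''] show ?case by simp
next
  case (WhileTrue s a P t s' u0 s0)
  from WhileTrue.prems obtain t1 s1 u1
    where 1: "exec P s t1 s1" "exec (WhileNZ a P) s1 u1 s''" "u = 1 + t1 + u1"
    by (rule exec_elims(10)) (use WhileTrue.hyps in simp_all)
  from WhileTrue.IH(1)[OF 1(1)] have "t1 = t" "s1 = s'" by blast+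
  with 1 WhileTrue.IH(2)[of u1 s''] show ?case by simp
next
  case (WhileFalse s a P)
  from WhileFalse.prems show ?case by (rule exec_elims(10)) (use WhileFalse.hyps in simp_all)
qed (auto elim: exec_elims(1-7))

text \<open>Initially register 0 holds the length of the input list and the memory cells
  $0, 1, \dots$ hold its entries; everything else is 0.\<close>

definition input_state :: "nat list \<Rightarrow> state" where
  "input_state xs =
     ((\<lambda>r. if r = 0 then length xs else 0), (\<lambda>i. if i < length xs then xs ! i else 0))"

definition output_value :: "state \<Rightarrow> nat" where
  "output_value s = fst s 0"

definition computes_in_time ::
    "prog \<Rightarrow> (nat list \<Rightarrow> bool) \<Rightarrow> (nat list \<Rightarrow> nat) \<Rightarrow> (nat \<Rightarrow> nat) \<Rightarrow> bool" where
  "computes_in_time P D f T \<longleftrightarrow> (\<forall>xs. D xs \<longrightarrow>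
     (\<exists>t s. exec P (input_state xs) t s \<and> output_value s = f xs \<and> t \<le> T (length xs)))"

end

theory Submission
  imports Defs
begin

text \<open>Since \<open>m = length \<sigma>\<close> is fixed, the $n^m$ tuples of positions of \<open>\<pi>\<close> can be enumerated
  by \<open>m\<close> nested loops, and it suffices to test each tuple in linear time. The tail positions
  are those whose letter differs by one from its predecessor, so maximality of adjacencies
  need not be tested.\<close>

section \<open>Counting tuples of positions\<close>

text \<open>Two neighbouring letters with consecutive values already form a run, and run lengths are
  bounded by \<open>length \<pi>\<close>, so this run extends to a maximal one.\<close>

lemma in_tail_iff:
  "in_tail \<pi> (Suc k) \<longleftrightarrow>
     Suc k < length \<pi> \<and> (\<pi> ! Suc k = \<pi> ! k + 1 \<or> \<pi> ! k = \<pi> ! Suc k + 1)"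
proof
  assume "in_tail \<pi> (Suc k)"
  then obtain i j where "consecutive_run \<pi> i j" "i < Suc k" "Suc k \<le> j"
    unfolding in_tail_def adjacency_def by blast
  then show "Suc k < length \<pi> \<and> (\<pi> ! Suc k = \<pi> ! k + 1 \<or> \<pi> ! k = \<pi> ! Suc k + 1)"
    unfolding consecutive_run_def by auto
next
  assume R: "Suc k < length \<pi> \<and> (\<pi> ! Suc k = \<pi> ! k + 1 \<or> \<pi> ! k = \<pi> ! Suc k + 1)"
  \<comment> \<open>\<open>C\<close> consists of the runs covering both \<open>k\<close> and
    \<open>Suc k\<close>. A longest one is an adjacency, since any run containing it lies in
    \<open>C\<close> again.\<close>
  define C where "C = {(i, j). consecutive_run \<pi> i j \<and> i \<le> k \<and> Suc k \<le> j}"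
  have "C \<subseteq> {..<length \<pi>} \<times> {..<length \<pi>}"
    unfolding C_def consecutive_run_def by auto
  then have "finite C"
    by (rule finite_subset) simp
  have "(k, Suc k) \<in> C"
    using R unfolding C_def consecutive_run_def by auto
  define len :: "nat \<times> nat \<Rightarrow> nat" where "len = (\<lambda>(i, j). j - i)"
  obtain i j where ij: "(i, j) \<in> C" "len (i, j) = Max (len ` C)"
    using Max_in[of "len ` C"] \<open>finite C\<close> \<open>(k, Suc k) \<in> C\<close>
    by (metis (no_types, opaque_lifting) empty_iff finite_imageI image_iff surj_pair)
  have "adjacency \<pi> i j"
    unfolding adjacency_def
  proof (intro conjI allI impI)
    show "consecutive_run \<pi> i j"
      using ij(1) by (simp add: C_def)
    fix i' j'
    assume *: "consecutive_run \<pi> i' j' \<and> {i..j} \<subseteq> {i'..j'}"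
    have "i \<le> j" using \<open>consecutive_run \<pi> i j\<close> by (simp add: consecutive_run_def)
    with * have le: "i' \<le> i" "j \<le> j'" by auto
    with * ij(1) have "(i', j') \<in> C" by (auto simp: C_def)
    then have "len (i', j') \<le> len (i, j)"
      using ij(2) \<open>finite C\<close> by simp
    with le \<open>i \<le> j\<close> have "i' = i" "j' = j" by (auto simp: len_def)
    then show "{i'..j'} = {i..j}" by simp
  qed
  then show "in_tail \<pi> (Suc k)"
    using ij(1) unfolding in_tail_def C_def by (auto intro: le_imp_less_Suc)
qed

lemma not_in_tail_0 [simp]: "\<not> in_tail \<pi> 0"
  by (simp add: in_tail_def)

text \<open>The position test over all pairs makes a tuple of length \<open>length \<sigma>\<close>
  strictly increasing, so every set of positions is represented only once. Letters come from the
  memory \<open>M\<close>, as the program reads them.\<close>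

definition good_tuple :: "nat list \<Rightarrow> nat \<Rightarrow> (nat \<Rightarrow> nat) \<Rightarrow> nat list \<Rightarrow> bool" where
  "good_tuple \<sigma> n M ys \<longleftrightarrow>
     (\<forall>a<length \<sigma>. \<forall>b<length \<sigma>. (ys ! a < ys ! b \<longleftrightarrow> a < b) \<and>
        (M (ys ! a) < M (ys ! b) \<longleftrightarrow> \<sigma> ! a < \<sigma> ! b)) \<and>
     (\<forall>k. Suc k < n \<longrightarrow> M (Suc k) = M k + 1 \<or> M k = M (Suc k) + 1 \<longrightarrow> Suc k \<in> set ys)"

lemma nths_eq_map_nth: "nths xs I = map ((!) xs) (filter (\<lambda>i. i \<in> I) [0..<length xs])"
proof -
  have "zip xs [0..<length xs] = map (\<lambda>i. (xs ! i, i)) [0..<length xs]"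
    by (rule nth_equalityI) auto
  then show ?thesis
    by (simp add: nths_def filter_map o_def)
qed

lemma sorted_list_of_subset_lessThan:
  assumes "I \<subseteq> {..<n}"
  shows "sorted_list_of_set I = filter (\<lambda>i. i \<in> I) [0..<n]"
proof -
  have "set (filter (\<lambda>i. i \<in> I) [0..<n]) = I" using assms by auto
  then show ?thesis
    by (metis sorted_list_of_set.idem_if_sorted_distinct distinct_filter distinct_upt
        sorted_wrt_filter sorted_upt)
qed

text \<open>Letters of a permutation are nonzero, so the zeros of an embedding reveal which
  positions were left out.\<close>

lemma NE_eq_card_positions:
  assumes "is_perm \<pi>"
  shows "NE \<sigma> \<pi> = card {I. occurrence \<sigma> \<pi> I \<and> (\<forall>k. in_tail \<pi> k \<longrightarrow> k \<in> I)}" (is "_ = card ?A")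
proof -
  let ?f = "\<lambda>I. map (\<lambda>i. if i \<in> I then \<pi> ! i else 0) [0..<length \<pi>]"
  have "set \<pi> = {1..length \<pi>}"
    using assms by (simp add: is_perm_def permutations_of_set_def)
  then have pos: "\<pi> ! i \<noteq> 0" if "i < length \<pi>" for i
    using nth_mem[OF that] by auto
  have tail: "k < length \<pi>" if "in_tail \<pi> k" for k
    using that by (cases k) (auto simp: in_tail_iff)
  have "inj_on ?f ?A"
  proof (rule inj_onI)
    fix I J
    assume I: "I \<in> ?A" and J: "J \<in> ?A" and eq: "?f I = ?f J"
    have "i \<in> I \<longleftrightarrow> i \<in> J" if "i < length \<pi>" for i
    proof -
      have "?f I ! i = ?f J ! i" by (simp only: eq)
      with that pos[OF that] show ?thesis by (simp split: if_splits)
    qed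
    with I J show "I = J" by (auto simp: occurrence_def)
  qed
  moreover have "{\<eta>. normal_embedding \<sigma> \<pi> \<eta>} = ?f ` ?A"
  proof (intro equalityI subsetI)
    fix \<eta> assume "\<eta> \<in> {\<eta>. normal_embedding \<sigma> \<pi> \<eta>}"
    then obtain I where I: "length \<eta> = length \<pi>" "occurrence \<sigma> \<pi> I"
      "\<And>i. i < length \<pi> \<Longrightarrow> \<eta> ! i = (if i \<in> I then \<pi> ! i else 0)"
      "\<And>k. k < length \<pi> \<Longrightarrow> in_tail \<pi> k \<Longrightarrow> \<eta> ! k \<noteq> 0"
      unfolding normal_embedding_def embedding_def by blast
    have "\<eta> = ?f I" using I(1,3) by (intro nth_equalityI) auto
    moreover have "k \<in> I" if "in_tail \<pi> k" for k
      using I(3)[of k] I(4)[of k] tail[of k] that by (auto split: if_splits)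
    ultimately show "\<eta> \<in> ?f ` ?A" using I(2) by blast
  next
    fix \<eta> assume "\<eta> \<in> ?f ` ?A"
    then show "\<eta> \<in> {\<eta>. normal_embedding \<sigma> \<pi> \<eta>}"
      using pos by (auto simp: normal_embedding_def embedding_def)
  qed
  ultimately show ?thesis
    unfolding NE_def by (simp add: card_image)
qed

text \<open>Strictly increasing lists correspond to finite sets through \<open>set\<close>, with
  inverse \<open>sorted_list_of_set\<close>.\<close>

lemma NE_eq_card_good_tuples:
  assumes "is_perm \<pi>" and M: "\<And>i. i < length \<pi> \<Longrightarrow> M i = \<pi> ! i"
  shows "NE \<sigma> \<pi> = card {ys. length ys = length \<sigma> \<and> set ys \<subseteq> {..<length \<pi>} \<and>
    good_tuple \<sigma> (length \<pi>) M ys}" (is "_ = card ?B")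
proof -
  let ?A = "{I. occurrence \<sigma> \<pi> I \<and> (\<forall>k. in_tail \<pi> k \<longrightarrow> k \<in> I)}"
  have tail: "(\<forall>k. in_tail \<pi> k \<longrightarrow> k \<in> I) \<longleftrightarrow>
    (\<forall>k. Suc k < length \<pi> \<longrightarrow> M (Suc k) = M k + 1 \<or> M k = M (Suc k) + 1 \<longrightarrow> Suc k \<in> I)"
    (is "_ \<longleftrightarrow> ?T I") for I
  proof -
    have "(\<forall>k. in_tail \<pi> k \<longrightarrow> k \<in> I) \<longleftrightarrow> (\<forall>k. in_tail \<pi> (Suc k) \<longrightarrow> Suc k \<in> I)"
      by (metis not_in_tail_0 not0_implies_Suc)
    then show ?thesis
      by (auto simp: in_tail_iff M)
  qed
  have occ: "occurrence \<sigma> \<pi> (set ys) \<longleftrightarrow> length ys = length \<sigma> \<and>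
      (\<forall>a<length \<sigma>. \<forall>b<length \<sigma>. M (ys ! a) < M (ys ! b) \<longleftrightarrow> \<sigma> ! a < \<sigma> ! b)"
    if "sorted_wrt (<) ys" "set ys \<subseteq> {..<length \<pi>}" for ys
  proof -
    have "nths \<pi> (set ys) = map ((!) \<pi>) ys"
      using that sorted_list_of_subset_lessThan[OF that(2)]
      by (simp add: nths_eq_map_nth strict_sorted_iff sorted_list_of_set.idem_if_sorted_distinct)
    moreover have "M (ys ! a) = \<pi> ! (ys ! a)" if "a < length ys" for a
      using \<open>set ys \<subseteq> _\<close> nth_mem[OF that] by (intro M) auto
    ultimately show ?thesis
      using that(2) by (auto simp: occurrence_def same_relative_order_def)
  qed
  have sorted: "sorted_wrt (<) ys \<longleftrightarrow>
      (\<forall>a<length \<sigma>. \<forall>b<length \<sigma>. ys ! a < ys ! b \<longleftrightarrow> a < b)"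
    if "length ys = length \<sigma>" for ys :: "nat list"
    using strict_mono_on_less[of "{..<length \<sigma>}" "(!) ys"] that
    unfolding sorted_wrt_iff_nth_less strict_mono_on_def by auto
  have B: "?B = {ys. sorted_wrt (<) ys \<and> set ys \<subseteq> {..<length \<pi>} \<and> set ys \<in> ?A}"
    using sorted occ tail unfolding good_tuple_def by auto
  have "bij_betw set ?B ?A"
  proof (rule bij_betw_imageI)
    show "inj_on set ?B"
      unfolding B by (rule inj_onI) (auto intro: strict_sorted_equal)
    show "set ` ?B = ?A"
    proof (intro equalityI subsetI)
      fix I assume "I \<in> ?A"
      moreover from this have "I \<subseteq> {..<length \<pi>}" by (simp add: occurrence_def)
      moreover from this have "finite I" by (rule finite_subset) simp
      ultimately have "sorted_list_of_set I \<in> ?B" "I = set (sorted_list_of_set I)"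
        unfolding B by auto
      then show "I \<in> set ` ?B" by blast
    qed (auto simp: B)
  qed
  then show ?thesis
    using NE_eq_card_positions[OF assms(1)] by (simp add: bij_betw_same_card)
qed

section \<open>Counting tuples along a nest of loops\<close>

fun count_ext :: "(nat list \<Rightarrow> bool) \<Rightarrow> nat \<Rightarrow> nat \<Rightarrow> nat list \<Rightarrow> nat" where
  "count_ext G n 0 zs = of_bool (G zs)"
| "count_ext G n (Suc d) zs = (\<Sum>i<n. count_ext G n d (i # zs))"

text \<open>The tuples are split by the last entry of \<open>ys\<close>, the one next to
  \<open>zs\<close>: they are filled from the back, because the outermost loop fixes the component
  with the largest index.\<close>

lemma count_ext_eq_card:
  "count_ext G n d zs = card {ys. length ys = d \<and> set ys \<subseteq> {..<n} \<and> G (ys @ zs)}"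
proof (induction d arbitrary: zs)
  case 0
  have "{ys. length ys = 0 \<and> set ys \<subseteq> {..<n} \<and> G (ys @ zs)} = (if G zs then {[]} else {})"
    by auto
  then show ?case by simp
next
  case (Suc d)
  let ?S = "\<lambda>i. {ys. length ys = d \<and> set ys \<subseteq> {..<n} \<and> G (ys @ i # zs)}"
  have fin: "finite (?S i)" for i
    by (rule finite_subset[OF _ finite_lists_length_eq[of "{..<n}" d]]) auto
  have "{ys. length ys = Suc d \<and> set ys \<subseteq> {..<n} \<and> G (ys @ zs)} =
      (\<Union>i<n. (\<lambda>ys. ys @ [i]) ` ?S i)" (is "?L = ?R")
  proof (intro equalityI subsetI)
    fix ys assume "ys \<in> ?L"
    then show "ys \<in> ?R" by (cases ys rule: rev_cases) auto
  qed auto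
  also have "card \<dots> = (\<Sum>i<n. card ((\<lambda>ys. ys @ [i]) ` ?S i))"
    by (intro card_UN_disjoint) (use fin in auto)
  also have "\<dots> = (\<Sum>i<n. card (?S i))"
    by (intro sum.cong refl card_image inj_onI) auto
  finally show ?case by (simp add: Suc)
qed

section \<open>Reasoning about programs\<close>

text \<open>Weakest precondition for total correctness, with the elapsed time passed to the
  postcondition. By determinism the run that exists is the only halting one.\<close>

definition wp :: "prog \<Rightarrow> (nat \<Rightarrow> state \<Rightarrow> bool) \<Rightarrow> state \<Rightarrow> bool" where
  "wp P Q s \<longleftrightarrow> (\<exists>t s'. exec P s t s' \<and> Q t s')"

lemma wp_mono: "wp P Q s \<Longrightarrow> (\<And>t s'. Q t s' \<Longrightarrow> Q' t s') \<Longrightarrow> wp P Q' s"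
  unfolding wp_def by blast

lemma exec_iff:
  "exec Skip s t s' \<longleftrightarrow> t = 1 \<and> s' = s"
  "exec (Const r k) (R, M) t s' \<longleftrightarrow> t = 1 \<and> s' = (R(r := k), M)"
  "exec (Copy r a) (R, M) t s' \<longleftrightarrow> t = 1 \<and> s' = (R(r := R a), M)"
  "exec (Add r a b) (R, M) t s' \<longleftrightarrow> t = 1 \<and> s' = (R(r := R a + R b), M)"
  "exec (Sub r a b) (R, M) t s' \<longleftrightarrow> t = 1 \<and> s' = (R(r := R a - R b), M)"
  "exec (Load r a) (R, M) t s' \<longleftrightarrow> t = 1 \<and> s' = (R(r := M (R a)), M)"
  "exec (Seq P Q) s t s' \<longleftrightarrow> (\<exists>t1 t2 s1. t = t1 + t2 \<and> exec P s t1 s1 \<and> exec Q s1 t2 s')"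
  "exec (IfNZ a P Q) s t s' \<longleftrightarrow> (\<exists>t1. t = 1 + t1 \<and> (if fst s a \<noteq> 0 then exec P s t1 s' else exec Q s t1 s'))"
proof -
  show "exec (Seq P Q) s t s' \<longleftrightarrow> (\<exists>t1 t2 s1. t = t1 + t2 \<and> exec P s t1 s1 \<and> exec Q s1 t2 s')"
    by (blast elim: exec_elims(8) intro: exec.Seq)
  show "exec (IfNZ a P Q) s t s' \<longleftrightarrow>
      (\<exists>t1. t = 1 + t1 \<and> (if fst s a \<noteq> 0 then exec P s t1 s' else exec Q s t1 s'))"
    by (cases "fst s a = 0") (auto elim!: exec_elims(9) intro: exec.IfTrue[simplified] exec.IfFalse[simplified])
qed (auto elim: exec_elims(1-7) intro: exec.intros[unfolded One_nat_def])

lemma wp_simps [simp]: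
  "wp Skip Q s \<longleftrightarrow> Q 1 s"
  "wp (Const r k) Q (R, M) \<longleftrightarrow> Q 1 (R(r := k), M)"
  "wp (Copy r a) Q (R, M) \<longleftrightarrow> Q 1 (R(r := R a), M)"
  "wp (Add r a b) Q (R, M) \<longleftrightarrow> Q 1 (R(r := R a + R b), M)"
  "wp (Sub r a b) Q (R, M) \<longleftrightarrow> Q 1 (R(r := R a - R b), M)"
  "wp (Load r a) Q (R, M) \<longleftrightarrow> Q 1 (R(r := M (R a)), M)"
  "wp (Seq P P') Q s \<longleftrightarrow> wp P (\<lambda>t. wp P' (\<lambda>u. Q (t + u))) s"
  "wp (IfNZ a P P') Q s \<longleftrightarrow> (if fst s a \<noteq> 0 then wp P (\<lambda>t. Q (1 + t)) s else wp P' (\<lambda>t. Q (1 + t)) s)"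
  unfolding wp_def exec_iff by (auto simp del: split_paired_Ex split_paired_All) metis

text \<open>The index of \<open>Inv\<close> is the exact number of iterations left. Each of them
  pays 1 for the test and at most \<open>T\<close> for the body; the final failing test costs
  1.\<close>

lemma wp_WhileNZ:
  assumes step: "\<And>k s. Inv (Suc k) s \<Longrightarrow> fst s a \<noteq> 0 \<and> wp P (\<lambda>t s'. t \<le> T \<and> Inv k s') s"
    and exit: "\<And>s. Inv 0 s \<Longrightarrow> fst s a = 0"
    and "Inv k s"
  shows "wp (WhileNZ a P) (\<lambda>t s'. t \<le> 1 + k * (T + 1) \<and> Inv 0 s') s"
  using \<open>Inv k s\<close>
proof (induction k arbitrary: s)
  case 0
  then have "exec (WhileNZ a P) s 1 s" by (intro exec.intros exit)
  with 0 show ?case unfolding wp_def by (intro exI[of _ 1] exI[of _ s]) simp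
next
  case (Suc k)
  from step[OF Suc.prems] obtain t s' where
    1: "fst s a \<noteq> 0" "exec P s t s'" "t \<le> T" "Inv k s'" unfolding wp_def by blast
  from Suc.IH[OF 1(4)] obtain u s'' where
    2: "exec (WhileNZ a P) s' u s''" "u \<le> 1 + k * (T + 1)" "Inv 0 s''" unfolding wp_def by blast
  have "exec (WhileNZ a P) s (1 + t + u) s''"
    using 1 2 by (intro exec.intros)
  moreover have "1 + t + u \<le> 1 + Suc k * (T + 1)" using 1 2 by simp
  ultimately show ?case using 2(3) unfolding wp_def by blast
qed

text \<open>A test signals failure by clearing the flag register \<open>F\<close> and success by
  leaving it alone, so tests run in sequence form a conjunction.\<close>

definition check ::
    "nat \<Rightarrow> ((nat \<Rightarrow> nat) \<Rightarrow> bool) \<Rightarrow> (nat \<Rightarrow> nat) \<Rightarrow> prog \<Rightarrow> bool \<Rightarrow> nat \<Rightarrow> bool" where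
  "check F I M P b T \<longleftrightarrow> (\<forall>R. I R \<longrightarrow> wp P (\<lambda>t s. t \<le> T \<and> snd s = M \<and> I (fst s) \<and>
     fst s F = (if b then R F else 0)) (R, M))"

definition seqs :: "prog list \<Rightarrow> prog" where
  "seqs Ps = foldr Seq Ps Skip"

lemma seqs_simps [simp]: "seqs [] = Skip" "seqs (P # Ps) = Seq P (seqs Ps)"
  by (simp_all add: seqs_def)

lemma check_Seq:
  assumes "check F I M P b T" "check F I M P' b' T'"
  shows "check F I M (Seq P P') (b \<and> b') (T + T')"
  unfolding check_def
proof (intro allI impI)
  fix R assume "I R"
  then show "wp (Seq P P') (\<lambda>t s. t \<le> T + T' \<and> snd s = M \<and> I (fst s) \<and>
     fst s F = (if b \<and> b' then R F else 0)) (R, M)"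
    unfolding wp_simps
    by (intro wp_mono[OF assms(1)[unfolded check_def, rule_format]])
      (auto intro!: wp_mono[OF assms(2)[unfolded check_def, rule_format]])
qed

text \<open>The summand 1 pays for the \<open>Skip\<close> that ends \<open>seqs\<close>.\<close>

lemma check_seqs:
  assumes "\<And>x. x \<in> set xs \<Longrightarrow> check F I M (P x) (b x) T"
  shows "check F I M (seqs (map P xs)) (\<forall>x\<in>set xs. b x) (1 + length xs * T)"
  using assms
proof (induction xs)
  case Nil
  show ?case by (simp add: check_def)
next
  case (Cons x xs)
  have "check F I M (seqs (map P xs)) (\<forall>x\<in>set xs. b x) (1 + length xs * T)"
    using Cons by simp
  from check_Seq[OF Cons.prems[of x] this] show ?case
    by (simp add: algebra_simps)
qed

section \<open>The program\<close>

text \<open>Register 0 holds the length of the input, 1 the number of good tuples found so far,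
  2 the constant 1, 3 the flag of the current tuple, and \<open>10 + a\<close> the \<open>a\<close>-th
  position of the current tuple. The registers 4 to 8 are scratch.\<close>

definition regs :: "nat \<Rightarrow> nat \<Rightarrow> nat list \<Rightarrow> nat \<Rightarrow> (nat \<Rightarrow> nat) \<Rightarrow> bool" where
  "regs n d zs c R \<longleftrightarrow> R 0 = n \<and> R 1 = c \<and> R 2 = 1 \<and> (\<forall>a<length zs. R (10 + (d + a)) = zs ! a)"

lemma regs_upd [simp]: "3 \<le> r \<Longrightarrow> r < 10 \<Longrightarrow> regs n d zs c (R(r := v)) \<longleftrightarrow> regs n d zs c R"
  by (auto simp: regs_def)

text \<open>A truncated difference is nonzero exactly if the subtrahend is smaller. The expected
  outcome \<open>b\<close> is known when the program is built, so it selects the code instead of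
  being computed at run time.\<close>

definition compare :: "nat \<Rightarrow> nat \<Rightarrow> bool \<Rightarrow> prog" where
  "compare x y b = Seq (Sub 4 y x)
     (if b then IfNZ 4 Skip (Const 3 0) else IfNZ 4 (Const 3 0) Skip)"

definition pair_check :: "nat list \<Rightarrow> nat \<times> nat \<Rightarrow> prog" where
  "pair_check \<sigma> = (\<lambda>(a, b). Seq (compare (10 + a) (10 + b) (a < b))
     (Seq (Load 4 (10 + a)) (Seq (Load 5 (10 + b)) (compare 4 5 (\<sigma> ! a < \<sigma> ! b)))))"

text \<open>One of the two truncated differences is 0, so their sum is the absolute difference.
  Register 6 serves as a second flag, cleared when component \<open>a\<close> equals register
  8.\<close>

definition differs :: "nat \<Rightarrow> prog" where
  "differs a = Seq (Sub 4 8 (10 + a)) (Seq (Sub 5 (10 + a) 8) (Seq (Add 4 4 5)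
     (IfNZ 4 Skip (Const 6 0))))"

text \<open>If register 7 holds \<open>k + 1\<close> on entry, register 5 receives the absolute
  difference of the letters at \<open>k + 1\<close> and \<open>k\<close>. If it is nonzero but
  vanishes after subtracting 1, then \<open>k + 1\<close>, saved in register 8, is a tail position
  and is searched for in the tuple.\<close>

definition tail_step :: "nat \<Rightarrow> prog" where
  "tail_step m = seqs [Load 4 7, Copy 8 7, Sub 7 7 2, Load 5 7, Sub 6 4 5, Sub 5 5 4, Add 5 5 6,
     IfNZ 5
       (Seq (Sub 5 5 2) (IfNZ 5 Skip
         (Seq (Const 6 1) (Seq (seqs (map differs [0..<m])) (IfNZ 6 (Const 3 0) Skip)))))
       Skip]"

definition tail_check :: "nat \<Rightarrow> prog" where
  "tail_check m = Seq (Sub 7 0 2) (WhileNZ 7 (tail_step m))"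

definition tuple_step :: "nat list \<Rightarrow> prog" where
  "tuple_step \<sigma> = Seq (Const 3 1) (Seq
     (Seq (seqs (map (pair_check \<sigma>) (List.product [0..<length \<sigma>] [0..<length \<sigma>])))
       (tail_check (length \<sigma>)))
     (Add 1 1 3))"

text \<open>Register \<open>10 + d\<close> is both loop counter and tuple component. It is lowered
  before the body runs, so the body sees the values from \<open>n - 1\<close> down to 0, where
  \<open>n\<close> is the content of register 0.\<close>

fun nest :: "prog \<Rightarrow> nat \<Rightarrow> prog" where
  "nest P 0 = P"
| "nest P (Suc d) =
     Seq (Copy (10 + d) 0) (WhileNZ (10 + d) (Seq (Sub (10 + d) (10 + d) 2) (nest P d)))"

definition NE_prog :: "nat list \<Rightarrow> prog" where
  "NE_prog \<sigma> = Seq (Const 2 1) (Seq (nest (tuple_step \<sigma>) (length \<sigma>)) (Copy 0 1))"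

section \<open>Correctness and running time of the tests\<close>

lemma check_pair:
  assumes "a < length ys" "b < length ys"
  shows "check 3 (regs n 0 ys c) M (pair_check \<sigma> (a, b))
    ((ys ! a < ys ! b \<longleftrightarrow> a < b) \<and> (M (ys ! a) < M (ys ! b) \<longleftrightarrow> \<sigma> ! a < \<sigma> ! b)) 8"
proof -
  have "R (10 + a) = ys ! a \<and> R (10 + b) = ys ! b" if "regs n 0 ys c R" for R
    using that assms by (simp add: regs_def)
  then show ?thesis
    unfolding check_def pair_check_def compare_def by auto
qed

text \<open>The invariant also freezes registers 3, 7 and 8, so that the main flag, the loop counter
  and the position sought survive the search through the tuple.\<close>

lemma check_differs:
  assumes "a < length ys"
  shows "check 6 (\<lambda>R. regs n 0 ys c R \<and> R 3 = f \<and> R 7 = k \<and> R 8 = j) M (differs a) (ys ! a \<noteq> j) 5"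
proof -
  have "R (10 + a) = ys ! a" if "regs n 0 ys c R" for R
    using that assms by (simp add: regs_def)
  then show ?thesis
    unfolding check_def differs_def by auto
qed

lemma check_tail:
  assumes "length ys = m"
  shows "check 3 (regs n 0 ys c) M (tail_check m)
    (\<forall>k. Suc k < n \<longrightarrow> M (Suc k) = M k + 1 \<or> M k = M (Suc k) + 1 \<longrightarrow> Suc k \<in> set ys)
    (2 + n * (20 + m * 5))"
  unfolding check_def
proof (intro allI impI)
  fix R assume R: "regs n 0 ys c R"
  define good where
    "good k \<longleftrightarrow> (M (Suc k) = M k + 1 \<or> M k = M (Suc k) + 1 \<longrightarrow> Suc k \<in> set ys)" for k
  \<comment> \<open>Positions are visited downwards: at counter \<open>k\<close> the conditions
    \<open>good j\<close> with \<open>k \<le> j\<close> have been tested. The bound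
    \<open>k \<le> n - 1\<close> yields \<open>Suc k < n\<close> in the loop body.\<close>
  define Inv where "Inv k s \<longleftrightarrow> snd s = M \<and> regs n 0 ys c (fst s) \<and> fst s 7 = k \<and>
    fst s 3 = (if \<forall>j. k \<le> j \<and> Suc j < n \<longrightarrow> good j then R 3 else 0)
    \<and> k \<le> n - 1" for k and s :: state
  have mem: "wp (seqs (map differs [0..<m])) (\<lambda>t s. t \<le> 1 + m * 5 \<and> snd s = M \<and>
      (regs n 0 ys c (fst s) \<and> fst s 3 = f \<and> fst s 7 = k \<and> fst s 8 = j) \<and>
      fst s 6 = (if j \<notin> set ys then R' 6 else 0)) (R', M)"
    if "regs n 0 ys c R' \<and> R' 3 = f \<and> R' 7 = k \<and> R' 8 = j" for R' f k j
  proof -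
    have "check 6 (\<lambda>R. regs n 0 ys c R \<and> R 3 = f \<and> R 7 = k \<and> R 8 = j) M
        (seqs (map differs [0..<m])) (\<forall>a\<in>set [0..<m]. ys ! a \<noteq> j) (1 + length [0..<m] * 5)"
      by (rule check_seqs) (rule check_differs, simp add: assms)
    moreover have "(\<forall>a\<in>set [0..<m]. ys ! a \<noteq> j) \<longleftrightarrow> j \<notin> set ys"
      using assms by (auto simp: in_set_conv_nth)
    ultimately show ?thesis
      using that unfolding check_def by simp
  qed
  have step: "fst s 7 \<noteq> 0 \<and> wp (tail_step m) (\<lambda>t s'. t \<le> 19 + m * 5 \<and> Inv k s') s"
    if "Inv (Suc k) s" for k s
  proof -
    have "snd s = M" using that by (simp add: Inv_def)
    then obtain R1 where s: "s = (R1, M)" by (cases s) simp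
    have R1: "regs n 0 ys c R1" "R1 7 = Suc k" "R1 2 = 1" "Suc k < n"
      "R1 3 = (if \<forall>j. Suc k \<le> j \<and> Suc j < n \<longrightarrow> good j then R 3 else 0)"
      using that unfolding s Inv_def by (auto simp: regs_def)
    have split: "(\<forall>j. k \<le> j \<and> Suc j < n \<longrightarrow> good j) \<longleftrightarrow>
        good k \<and> (\<forall>j. Suc k \<le> j \<and> Suc j < n \<longrightarrow> good j)"
      using R1(4) by (metis Suc_leD Suc_leI le_eq_less_or_eq le_refl)
    obtain D where D: "M k - M (Suc k) + (M (Suc k) - M k) = D" by blast
    then have adj: "M (Suc k) = M k + 1 \<or> M k = M (Suc k) + 1 \<longleftrightarrow> D = 1" by arith
    show ?thesis
    proof (cases "D = 1")
      case False
      then have "good k" using adj by (simp add: good_def)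
      \<comment> \<open>These are the two ways around the membership test: the outer conditional
        fails, or the inner one takes its \<open>Skip\<close> branch.\<close>
      moreover have "D = 0 \<or> D - 1 \<noteq> 0" using False by arith
      ultimately show ?thesis
        using R1 unfolding s tail_step_def by (auto simp: Inv_def split D)
    next
      case True
      then have "good k \<longleftrightarrow> Suc k \<in> set ys" using adj by (simp add: good_def)
      then show ?thesis
        using R1 True unfolding s tail_step_def
        by (auto intro!: wp_mono[OF mem[of _ "R1 3" k "Suc k"]] simp: Inv_def split D)
    qed
  qed
  \<comment> \<open>No \<open>j\<close> satisfies both \<open>n - 1 \<le> j\<close> and
    \<open>Suc j < n\<close>, so the flag still has its initial value.\<close>
  have "Inv (n - 1) (R(7 := n - 1), M)"
    using R unfolding Inv_def by auto
  then have "wp (WhileNZ 7 (tail_step m)) (\<lambda>t s'. t \<le> 1 + (n - 1) * (19 + m * 5 + 1) \<and> Inv 0 s')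
      (R(7 := n - 1), M)"
    by (intro wp_WhileNZ[where Inv = Inv]) (erule step, simp add: Inv_def)
  moreover have "(n - 1) * (19 + m * 5 + 1) \<le> n * (20 + m * 5)"
    by (intro mult_mono) auto
  ultimately have "wp (WhileNZ 7 (tail_step m)) (\<lambda>t s'. t \<le> 1 + n * (20 + m * 5) \<and> Inv 0 s')
      (R(7 := n - 1), M)"
    by (elim wp_mono conjE) (intro conjI, linarith)
  moreover have "R 0 = n" "R 2 = 1" using R by (simp_all add: regs_def)
  ultimately have "wp (tail_check m) (\<lambda>t s. t \<le> 2 + n * (20 + m * 5) \<and> snd s = M \<and> regs n 0 ys c (fst s) \<and>
     fst s 3 = (if \<forall>k. Suc k < n \<longrightarrow> good k then R 3 else 0)) (R, M)"
    unfolding tail_check_def by (auto elim!: wp_mono simp: Inv_def)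
  then show "wp (tail_check m) (\<lambda>t s. t \<le> 2 + n * (20 + m * 5) \<and> snd s = M \<and> regs n 0 ys c (fst s) \<and>
     fst s 3 = (if \<forall>k. Suc k < n \<longrightarrow> M (Suc k) = M k + 1 \<or> M k = M (Suc k) + 1 \<longrightarrow>
       Suc k \<in> set ys then R 3 else 0)) (R, M)"
    unfolding good_def .
qed

definition tuple_time :: "nat \<Rightarrow> nat \<Rightarrow> nat" where
  "tuple_time m n = 5 + m * m * 8 + n * (20 + m * 5)"

lemma wp_tuple_step:
  assumes "regs n 0 ys c R" "length ys = length \<sigma>"
  shows "wp (tuple_step \<sigma>) (\<lambda>t s. t \<le> tuple_time (length \<sigma>) n \<and> snd s = M \<and>
    regs n 0 ys (c + of_bool (good_tuple \<sigma> n M ys)) (fst s)) (R, M)"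
proof -
  let ?m = "length \<sigma>"
  let ?ps = "List.product [0..<?m] [0..<?m]"
  let ?b = "\<lambda>(a, b). (ys ! a < ys ! b \<longleftrightarrow> a < b) \<and> (M (ys ! a) < M (ys ! b) \<longleftrightarrow> \<sigma> ! a < \<sigma> ! b)"
  let ?P = "Seq (seqs (map (pair_check \<sigma>) ?ps)) (tail_check ?m)"
  have pairs: "check 3 (regs n 0 ys c) M (pair_check \<sigma> x) (?b x) 8" if "x \<in> set ?ps" for x
    using that check_pair[of "fst x" ys "snd x"] assms(2) by (auto simp: split_beta)
  have "(\<forall>x\<in>set ?ps. ?b x) \<longleftrightarrow> (\<forall>a<?m. \<forall>b<?m. ?b (a, b))"
    by auto
  then have "check 3 (regs n 0 ys c) M ?P (good_tuple \<sigma> n M ys)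
      (1 + ?m * ?m * 8 + (2 + n * (20 + ?m * 5)))"
    using check_Seq[OF check_seqs[of ?ps _ _ _ "pair_check \<sigma>" ?b, OF pairs] check_tail[OF assms(2)]]
    by (simp only: good_tuple_def length_product length_upt diff_zero prod.case)
  \<comment> \<open>The flag starts at 1, so it ends as 0 or 1 and can simply be added to the
    counter.\<close>
  from this[unfolded check_def, rule_format, of "R(3 := 1)"] assms(1)
  have "wp ?P (\<lambda>t s. t \<le> 3 + ?m * ?m * 8 + n * (20 + ?m * 5) \<and> snd s = M \<and>
      regs n 0 ys c (fst s) \<and> fst s 3 = of_bool (good_tuple \<sigma> n M ys)) (R(3 := 1), M)"
    by (auto elim!: wp_mono)
  then show ?thesis
    \<comment> \<open>Only the outer layers are unfolded; \<open>?P\<close> stays whole so that the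
      fact about it applies.\<close>
    unfolding tuple_step_def
    by (subst wp_simps, subst wp_simps, subst wp_simps)
      (auto elim!: wp_mono simp: regs_def tuple_time_def simp del: wp_simps(7))
qed

section \<open>The nest of loops and its running time\<close>

fun nest_time :: "(nat \<Rightarrow> nat) \<Rightarrow> nat \<Rightarrow> nat \<Rightarrow> nat" where
  "nest_time T 0 n = T n"
| "nest_time T (Suc d) n = 2 + n * (2 + nest_time T d n)"

text \<open>Induction on the number \<open>d\<close> of open components: components \<open>d\<close>
  to \<open>m - 1\<close> are fixed as \<open>zs\<close>, and each further loop puts one in front,
  just as \<open>count_ext\<close> does.\<close>

lemma wp_nest:
  assumes P: "\<And>ys c R. regs n 0 ys c R \<Longrightarrow> length ys = m \<Longrightarrow>
      wp P (\<lambda>t s. t \<le> T n \<and> snd s = M \<and> regs n 0 ys (c + of_bool (G ys)) (fst s)) (R, M)"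
    and "regs n d zs c R" "d + length zs = m"
  shows "wp (nest P d) (\<lambda>t s. t \<le> nest_time T d n \<and> snd s = M \<and>
    regs n d zs (c + count_ext G n d zs) (fst s)) (R, M)"
  using assms(2,3)
proof (induction d arbitrary: zs c R)
  case 0
  with P[of zs c R] show ?case by simp
next
  case (Suc d)
  \<comment> \<open>The counter runs downwards, so at value \<open>k\<close> the extensions by
    \<open>i \<ge> k\<close> have been counted.\<close>
  define Inv where "Inv k s \<longleftrightarrow> snd s = M \<and> k \<le> n \<and> fst s (10 + d) = k \<and>
    regs n (Suc d) zs (c + (\<Sum>i = k..<n. count_ext G n d (i # zs))) (fst s)" for k and s :: state
  have regs_Cons: "regs n d (k # zs) e R \<longleftrightarrow> R (10 + d) = k \<and> regs n (Suc d) zs e R" for k e R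
    by (auto simp: regs_def less_Suc_eq_0_disj)
  \<comment> \<open>The counter register lies just below those holding \<open>zs\<close> and above
    registers 0 to 2.\<close>
  have regs_set: "regs n (Suc d) zs e (R(10 + d := k)) \<longleftrightarrow> regs n (Suc d) zs e R" for k e R
    by (auto simp: regs_def)
  have step: "fst s (10 + d) \<noteq> 0 \<and> wp (Seq (Sub (10 + d) (10 + d) 2) (nest P d))
      (\<lambda>t s'. t \<le> 1 + nest_time T d n \<and> Inv k s') s" if "Inv (Suc k) s" for k s
  proof -
    have "snd s = M" using that by (simp add: Inv_def)
    then obtain R1 where s: "s = (R1, M)" by (cases s) simp
    let ?e = "c + (\<Sum>i = Suc k..<n. count_ext G n d (i # zs))"
    have R1: "R1 (10 + d) = Suc k" "R1 2 = 1" "Suc k \<le> n" "regs n (Suc d) zs ?e R1"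
      using that unfolding s Inv_def by (auto simp: regs_def)
    then have "regs n d (k # zs) ?e (R1(10 + d := k))"
      by (simp only: regs_Cons regs_set) simp
    then have "wp (nest P d) (\<lambda>t s. t \<le> nest_time T d n \<and> snd s = M \<and>
        regs n d (k # zs) (?e + count_ext G n d (k # zs)) (fst s)) (R1(10 + d := k), M)"
      by (rule Suc.IH) (use Suc.prems(2) in simp)
    moreover have "(\<Sum>i = k..<n. count_ext G n d (i # zs)) =
        count_ext G n d (k # zs) + (\<Sum>i = Suc k..<n. count_ext G n d (i # zs))"
      using R1(3) by (intro sum.atLeast_Suc_lessThan) simp
    ultimately show ?thesis
      using R1 unfolding s
      by (auto elim!: wp_mono simp: Inv_def regs_Cons ac_simps)
  qed
  have "Inv n (R(10 + d := n), M)"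
    using Suc.prems(1) by (auto simp: Inv_def regs_set simp del: fun_upd_apply) simp
  then have "wp (WhileNZ (10 + d) (Seq (Sub (10 + d) (10 + d) 2) (nest P d)))
      (\<lambda>t s'. t \<le> 1 + n * (1 + nest_time T d n + 1) \<and> Inv 0 s') (R(10 + d := n), M)"
    by (intro wp_WhileNZ[where Inv = Inv]) (erule step, simp add: Inv_def)
  moreover have "R 0 = n" using Suc.prems(1) by (simp add: regs_def)
  ultimately show ?case
    by (auto elim!: wp_mono simp: Inv_def lessThan_atLeast0)
qed

text \<open>The summand 2 pays for loading the constant 1 and for copying the result to register
  0.\<close>

lemma computes_NE_prog:
  "computes_in_time (NE_prog \<sigma>) is_perm (NE \<sigma>)
     (\<lambda>n. 2 + nest_time (tuple_time (length \<sigma>)) (length \<sigma>) n)"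
  unfolding computes_in_time_def
proof (intro allI impI)
  fix \<pi> assume "is_perm \<pi>"
  let ?m = "length \<sigma>" and ?n = "length \<pi>"
  obtain R M where RM: "input_state \<pi> = (R, M)" by fastforce
  \<comment> \<open>All components are still open, so only registers 0 to 2 are constrained.\<close>
  have regs: "regs ?n ?m [] 0 (R(2 := 1))"
    using RM by (auto simp: regs_def input_state_def)
  have M: "M i = \<pi> ! i" if "i < ?n" for i
    using RM that by (auto simp: input_state_def)
  have "NE \<sigma> \<pi> = count_ext (good_tuple \<sigma> ?n M) ?n ?m []"
    by (simp add: count_ext_eq_card NE_eq_card_good_tuples[OF \<open>is_perm \<pi>\<close> M])
  with wp_nest[of ?n ?m "tuple_step \<sigma>" "tuple_time ?m" M "good_tuple \<sigma> ?n M",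
      OF wp_tuple_step regs]
  have "wp (nest (tuple_step \<sigma>) ?m) (\<lambda>t s. t \<le> nest_time (tuple_time ?m) ?m ?n \<and>
      fst s 1 = NE \<sigma> \<pi>) (R(2 := 1), M)"
    by (auto elim!: wp_mono simp: regs_def)
  then have "wp (NE_prog \<sigma>) (\<lambda>t s. t \<le> 2 + nest_time (tuple_time ?m) ?m ?n \<and>
      output_value s = NE \<sigma> \<pi>) (R, M)"
    unfolding NE_prog_def by (auto elim!: wp_mono simp: output_value_def)
  then show "\<exists>t s. exec (NE_prog \<sigma>) (input_state \<pi>) t s \<and> output_value s = NE \<sigma> \<pi> \<and>
      t \<le> 2 + nest_time (tuple_time ?m) ?m ?n"
    unfolding RM wp_def by blast
qed

text \<open>The innermost cost is linear in \<open>n\<close>, and each loop level raises the degree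
  by one; the depth \<open>d\<close> does not depend on \<open>n\<close>.\<close>

lemma poly_nest_time: "\<exists>p. \<forall>n. poly p n = nest_time (tuple_time m) d n"
proof (induction d)
  case 0
  have "poly [:5 + m * m * 8, 20 + m * 5:] n = nest_time (tuple_time m) 0 n" for n
    by (simp add: tuple_time_def)
  then show ?case by blast
next
  case (Suc d)
  then obtain p where "\<And>n. poly p n = nest_time (tuple_time m) d n" by blast
  then have "poly ([:2:] + [:0, 1:] * ([:2:] + p)) n = nest_time (tuple_time m) (Suc d) n" for n
    by simp
  then show ?case by blast
qed

theorem proposition5:
  fixes \<sigma> :: "nat list"
  assumes "is_perm \<sigma>"
  shows "\<exists>P. \<exists>p :: nat poly. computes_in_time P is_perm (NE \<sigma>) (\<lambda>n. poly p n)"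
proof -
  obtain p where p: "\<And>n. poly p n = nest_time (tuple_time (length \<sigma>)) (length \<sigma>) n"
    using poly_nest_time by blast
  have "computes_in_time (NE_prog \<sigma>) is_perm (NE \<sigma>) (\<lambda>n. poly ([:2:] + p) n)"
    using computes_NE_prog[of \<sigma>] by (simp add: p)
  then show ?thesis by blast
qed

end
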